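(* Let $\mathcal{G}=(\mathcal{V},\mathcal{E})$ be a connected undirected graph and let $k>0$. Consider the Stackelberg attacker-defender game on $\mathcal{G}$ with payoff $J_2(\mathfrak{F},\mathfrak{D})$, a single attacked node and a single defense node ($|\mathfrak{F}|=|\mathfrak{D}|=1$), and the defender as the game leader. Then a solution of the game corresponds to the case when the defender chooses the effective center of $\mathcal{G}$, i.e. $\mathfrak{D}^*\in\arg\min_{v\in\mathcal{V}}\epsilon_f(v)$. In this case the best response of the attacker is $\mathcal{B}^*(\mathfrak{D}^* )\in\arg\max_{j\in\mathcal{V}}R_{\mathfrak{D}^*j}$, i.e. a node with the maximum effective resistance from $\mathfrak{D}^*$.
   Context: $\mathcal{G}$ is simple and unweighted, with Laplacian matrix $L=D-A$ ($A$ the adjacency matrix, $D$ the diagonal matrix of degrees). The effective resistance $R_{ij}$ between nodes $i$ and $j$ is the electrical resistance measured between $i$ and $j$ when the graph is viewed as an electrical circuit in which every edge has conductance $1$. The effective eccentricity of $v$ is $\epsilon_f(v)=\max_{u\in\mathcal{V}}R_{vu}$, and the effective center of $\mathcal{G}$ is the set of vertices with minimum effective eccentricity. For a nonempty set $\mathfrak{D}\subseteq\mathcal{V}$ of defense nodes, $D_y=\mathrm{diag}(y)$ with $y_i=1$ if $i\in\mathfrak{D}$ and $y_i=0$ otherwise, and $\bar L=L+kD_y$ (invertible). For a set $\mathfrak{F}\subseteq\mathcal{V}$ of $f$ attacked nodes the payoff is $$J_2(\mathfrak{F},\mathfrak{D})=\frac12 f+\frac12\sum_{i\in\mathfrak{F}}\bar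 L^{-1}_{ii},$$ where $\bar L^{-1}_{ii}$ is the $i$-th diagonal element of $\bar L^{-1}$. Stackelberg game with the defender as leader: the defender first chooses $\mathfrak{D}$ and the attacker, knowing $\mathfrak{D}$, chooses a best response $\mathfrak{F}\in\arg\max_{\mathfrak{F}}J_2(\mathfrak{F},\mathfrak{D})$. A solution (equilibrium) is a pair $(\mathfrak{D}^*,\mathfrak{F}^* )$ such that $\mathfrak{D}^*$ minimizes $\max_{\mathfrak{F}}J_2(\mathfrak{F},\mathfrak{D})$ over admissible $\mathfrak{D}$, and $\mathfrak{F}^*$ maximizes $J_2(\mathfrak{F},\mathfrak{D}^* )$ over admissible $\mathfrak{F}$ (here admissible sets are the singletons, identified with nodes). *)

theory Defs
  imports "HOL-Analysis.Analysis"
begin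

text \<open>
  A simple graph is given by a symmetric, irreflexive adjacency relation \<open>E\<close> on a finite type
  of vertices; the whole type is the vertex set.
\<close>

definition connected_graph :: "('v \<Rightarrow> 'v \<Rightarrow> bool) \<Rightarrow> bool" where
  "connected_graph E \<longleftrightarrow> (\<forall>u v. E\<^sup>*\<^sup>* u v)"

definition adjacency_matrix :: "('v::finite \<Rightarrow> 'v \<Rightarrow> bool) \<Rightarrow> real^'v^'v" where
  "adjacency_matrix E = (\<chi> i j. if E i j then 1 else 0)"

definition degree_matrix :: "('v::finite \<Rightarrow> 'v \<Rightarrow> bool) \<Rightarrow> real^'v^'v" where
  "degree_matrix E = (\<chi> i j. if i = j then real (card {w. E i w}) else 0)"

definition laplacian_matrix :: "('v::finite \<Rightarrow> 'v \<Rightarrow> bool) \<Rightarrow> real^'v^'v" where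
  "laplacian_matrix E = degree_matrix E - adjacency_matrix E"

definition defense_matrix :: "'v::finite set \<Rightarrow> real^'v^'v" where
  "defense_matrix D = (\<chi> i j. if i = j \<and> i \<in> D then 1 else 0)"

definition grounded_laplacian :: "('v::finite \<Rightarrow> 'v \<Rightarrow> bool) \<Rightarrow> real \<Rightarrow> 'v set \<Rightarrow> real^'v^'v" where
  "grounded_laplacian E k D = laplacian_matrix E + k *\<^sub>R defense_matrix D"

text \<open>
  \<open>c u w\<close> is the current flowing from \<open>u\<close> to \<open>w\<close> and \<open>p\<close> the electric potential, when a unit
  current is injected at \<open>i\<close> and extracted at \<open>j\<close>. The first conjunct is Ohm's law for edges of
  conductance 1, the second is Kirchhoff's current law.
\<close>

definition unit_current :: 
  "('v::finite \<Rightarrow> 'v \<Rightarrow> bool) \<Rightarrow> 'v \<Rightarrow> 'v \<Rightarrow> ('v \<Rightarrow> 'v \<Rightarrow> real) \<Rightarrow> ('v \<Rightarrow> real) \<Rightarrow> bool" where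
  "unit_current E i j c p \<longleftrightarrow>
     (\<forall>u w. c u w = (if E u w then p u - p w else 0)) \<and>
     (\<forall>u. (\<Sum>w\<in>UNIV. c u w) = (if u = i then 1 else 0) - (if u = j then 1 else 0))"

text \<open>
  The voltage between \<open>i\<close> and \<open>j\<close> per unit of current. In a connected graph the potential exists
  and is unique up to an additive constant, so the description below is proper.
\<close>

definition effective_resistance :: "('v::finite \<Rightarrow> 'v \<Rightarrow> bool) \<Rightarrow> 'v \<Rightarrow> 'v \<Rightarrow> real" where
  "effective_resistance E i j = (THE r. \<exists>c p. unit_current E i j c p \<and> r = p i - p j)"

definition effective_eccentricity :: "('v::finite \<Rightarrow> 'v \<Rightarrow> bool) \<Rightarrow> 'v \<Rightarrow> real" where
  "effective_eccentricity E v = (MAX u\<in>UNIV. effective_resistance E v u)"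

definition effective_center :: "('v::finite \<Rightarrow> 'v \<Rightarrow> bool) \<Rightarrow> 'v set" where
  "effective_center E = {v. is_arg_min (effective_eccentricity E) (\<lambda>_. True) v}"

definition payoff :: "('v::finite \<Rightarrow> 'v \<Rightarrow> bool) \<Rightarrow> real \<Rightarrow> 'v set \<Rightarrow> 'v set \<Rightarrow> real" where
  "payoff E k F D =
     1/2 * real (card F) + 1/2 * (\<Sum>i\<in>F. matrix_inv (grounded_laplacian E k D) $ i $ i)"

text \<open>In the game below the attacker picks \<open>f\<close> nodes and the defender \<open>d\<close> nodes.\<close>

definition best_response ::
  "('v::finite \<Rightarrow> 'v \<Rightarrow> bool) \<Rightarrow> real \<Rightarrow> nat \<Rightarrow> 'v set \<Rightarrow> 'v set \<Rightarrow> bool" where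
  "best_response E k f D F \<longleftrightarrow> is_arg_max (\<lambda>F'. payoff E k F' D) (\<lambda>F'. card F' = f) F"

definition optimal_defense ::
  "('v::finite \<Rightarrow> 'v \<Rightarrow> bool) \<Rightarrow> real \<Rightarrow> nat \<Rightarrow> nat \<Rightarrow> 'v set \<Rightarrow> bool" where
  "optimal_defense E k f d D \<longleftrightarrow>
     is_arg_min (\<lambda>D'. MAX F\<in>{F. card F = f}. payoff E k F D') (\<lambda>D'. card D' = d) D"

definition stackelberg_solution ::
  "('v::finite \<Rightarrow> 'v \<Rightarrow> bool) \<Rightarrow> real \<Rightarrow> nat \<Rightarrow> nat \<Rightarrow> 'v set \<Rightarrow> 'v set \<Rightarrow> bool" where
  "stackelberg_solution E k f d D F \<longleftrightarrow> optimal_defense E k f d D \<and> best_response E k f D F"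

end

theory Submission
  imports Defs
begin

text \<open>
  Everything rests on the identity \<open>matrix_inv (L + k e\<^sub>v e\<^sub>v\<^sup>T) $ j $ j = 1/k + R v j\<close>, where
  \<open>L\<close> is the Laplacian and \<open>R\<close> the effective resistance (\<open>matrix_inv_grounded_laplacian_diag\<close>).
  The \<open>j\<close>-th column \<open>x\<close> of the inverse solves \<open>L x + k x\<^sub>v e\<^sub>v = e\<^sub>j\<close>. The entries of \<open>L x\<close> add up
  to 0 because \<open>L\<close> is symmetric with zero row sums, so \<open>k x\<^sub>v = 1\<close>; hence \<open>L x = e\<^sub>j - e\<^sub>v\<close>, that is,
  \<open>x\<close> is the potential of a unit current from \<open>j\<close> to \<open>v\<close>, normalised to \<open>1/k\<close> at \<open>v\<close>. The
  resistance is the voltage \<open>x\<^sub>j - x\<^sub>v = x\<^sub>j - 1/k\<close>.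

  Physically, the defense node is tied to the ground through an extra resistor \<open>1/k\<close>, and the
  diagonal entry is the resistance from \<open>j\<close> to the ground: two resistances in series.

  The maximum principle (\<open>harmonic_imp_constant\<close>) gives both that the grounded Laplacian is
  invertible and that voltages do not depend on the chosen potential.

  For singletons the payoff is therefore a strictly increasing affine function of \<open>R v j\<close>, and
  its maximum over \<open>j\<close> the same function of the eccentricity of \<open>v\<close>. Such functions preserve
  maximisers and minimisers, which turns the two optimisations of the game into those that
  define the farthest nodes and the effective center.
\<close>

section \<open>Currents and the Laplacian\<close>

definition net_outflow :: "('v::finite \<Rightarrow> 'v \<Rightarrow> bool) \<Rightarrow> ('v \<Rightarrow> real) \<Rightarrow> 'v \<Rightarrow> real" where
  "net_outflow E p u = (\<Sum>w\<in>UNIV. if E u w then p u - p w else 0)"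

lemma net_outflow_diff:
  "net_outflow E (\<lambda>u. p u - q u) u = net_outflow E p u - net_outflow E q u"
  unfolding net_outflow_def sum_subtractf[symmetric]
  by (rule sum.cong) auto

lemma net_outflow_minus: "net_outflow E (\<lambda>u. - p u) u = - net_outflow E p u"
  unfolding net_outflow_def sum_negf[symmetric]
  by (rule sum.cong) auto

lemma laplacian_matrix_mult_vec: "(laplacian_matrix E *v x) $ u = net_outflow E (($) x) u"
proof -
  have "(laplacian_matrix E *v x) $ u
      = (\<Sum>w\<in>UNIV. (if u = w then real (card {w. E u w}) * x $ w else 0)
                    - (if E u w then x $ w else 0))"
    by (auto simp: laplacian_matrix_def degree_matrix_def adjacency_matrix_def
        matrix_vector_mult_def algebra_simps intro!: sum.cong)
  also have "\<dots> = real (card {w. E u w}) * x $ u - (\<Sum>w\<in>UNIV. if E u w then x $ w else 0)"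
    by (simp add: sum_subtractf)
  also have "real (card {w. E u w}) * x $ u = (\<Sum>w\<in>UNIV. if E u w then x $ u else 0)"
    by (simp add: sum.If_cases)
  also have "\<dots> - (\<Sum>w\<in>UNIV. if E u w then x $ w else 0) = net_outflow E (($) x) u"
    unfolding net_outflow_def sum_subtractf[symmetric] by (rule sum.cong) auto
  finally show ?thesis .
qed

text \<open>Every edge contributes its current with opposite signs at its two ends.\<close>

lemma sum_net_outflow_eq_0:
  assumes "symp E"
  shows "(\<Sum>u\<in>UNIV. net_outflow E p u) = 0"
proof -
  let ?c = "\<lambda>u w. if E u w then p u - p w else 0"
  have "(\<Sum>u\<in>UNIV. \<Sum>w\<in>UNIV. ?c u w) = (\<Sum>u\<in>UNIV. \<Sum>w\<in>UNIV. ?c w u)"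
    by (rule sum.swap)
  also have "\<dots> = (\<Sum>u\<in>UNIV. \<Sum>w\<in>UNIV. - ?c u w)"
    using sympD[OF assms] by (intro sum.cong) auto
  also have "\<dots> = - (\<Sum>u\<in>UNIV. \<Sum>w\<in>UNIV. ?c u w)"
    by (simp add: sum_negf)
  finally show ?thesis by (simp add: net_outflow_def)
qed

text \<open>
  The maximum principle: at a vertex where \<open>p\<close> is maximal all outgoing currents are nonnegative,
  so they vanish when they add up to 0. The maximum then spreads to all neighbours, and by
  connectedness to every vertex.
\<close>

lemma harmonic_imp_constant:
  assumes "connected_graph E" and harmonic: "\<And>u. net_outflow E p u = 0"
  shows "p u = p w"
proof -
  define m where "m = Max (range p)"
  have le: "p x \<le> m" for x by (simp add: m_def)
  have "m \<in> range p" unfolding m_def by (rule Max_in) auto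
  then obtain a where a: "p a = m" by auto
  have "p b = m" if "E\<^sup>*\<^sup>* a b" for b
    using that
  proof induction
    case base
    then show ?case by (rule a)
  next
    case (step y z)
    have "\<forall>w\<in>UNIV. (if E y w then p y - p w else 0) = 0"
      using harmonic[of y] le step.IH unfolding net_outflow_def
      by (subst (asm) sum_nonneg_eq_0_iff) auto
    then have "(if E y z then p y - p z else 0) = 0" by (rule bspec) simp
    with step show ?case by simp
  qed
  with assms(1) show ?thesis by (auto simp: connected_graph_def)
qed

lemma effective_resistance_eq:
  assumes "connected_graph E"
    and p: "\<And>u. net_outflow E p u = (if u = i then 1 else 0) - (if u = j then 1 else 0)"
  shows "effective_resistance E i j = p i - p j"
  unfolding effective_resistance_def
proof (rule the_equality)
  show "\<exists>c p'. unit_current E i j c p' \<and> p i - p j = p' i - p' j"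
    using p unfolding unit_current_def net_outflow_def
    by (intro exI[of _ "\<lambda>u w. if E u w then p u - p w else 0"] exI[of _ p]) simp
next
  fix r
  assume "\<exists>c q. unit_current E i j c q \<and> r = q i - q j"
  then obtain c q where cq: "unit_current E i j c q" and r: "r = q i - q j" by blast
  have "net_outflow E q u = (if u = i then 1 else 0) - (if u = j then 1 else 0)" for u
  proof -
    have "c u = (\<lambda>w. if E u w then q u - q w else 0)"
      using cq by (auto simp: unit_current_def)
    moreover have "(\<Sum>w\<in>UNIV. c u w) = (if u = i then 1 else 0) - (if u = j then 1 else 0)"
      using cq unfolding unit_current_def by blast
    ultimately show ?thesis by (simp add: net_outflow_def)
  qed
  with p have "net_outflow E (\<lambda>u. q u - p u) u = 0" for u
    by (simp add: net_outflow_diff)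
  from harmonic_imp_constant[OF assms(1) this, of i j] show "r = p i - p j"
    by (simp add: r)
qed

section \<open>The inverse of the grounded Laplacian\<close>

lemma grounded_laplacian_mult_vec:
  "(grounded_laplacian E k {v} *v x) $ u
     = net_outflow E (($) x) u + (if u = v then k * x $ v else 0)"
proof -
  have "(defense_matrix {v} *v x) $ u = (\<Sum>w\<in>UNIV. if u = w then (if u = v then x $ w else 0) else 0)"
    unfolding defense_matrix_def matrix_vector_mult_def vec_lambda_beta
    by (rule sum.cong) auto
  then have "(defense_matrix {v} *v x) $ u = (if u = v then x $ u else 0)"
    by simp
  then show ?thesis
    by (simp add: grounded_laplacian_def matrix_vector_mult_add_rdistrib
        scaleR_matrix_vector_assoc[symmetric] laplacian_matrix_mult_vec)
qed

text \<open>Summing all equations eliminates the Laplacian and isolates the value at \<open>v\<close>.\<close>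

lemma sum_grounded_laplacian_mult_vec:
  assumes "symp E"
  shows "(\<Sum>u\<in>UNIV. (grounded_laplacian E k {v} *v x) $ u) = k * x $ v"
  using sum_net_outflow_eq_0[OF assms, of "($) x"]
  by (simp add: grounded_laplacian_mult_vec sum.distrib)

lemma invertible_grounded_laplacian:
  assumes "symp E" and "connected_graph E" and "k \<noteq> 0"
  shows "invertible (grounded_laplacian E k {v})"
  unfolding invertible_left_inverse matrix_left_invertible_ker
proof (intro allI impI)
  fix x assume ker: "grounded_laplacian E k {v} *v x = 0"
  have xv: "x $ v = 0"
    using sum_grounded_laplacian_mult_vec[OF assms(1), of k v x] ker \<open>k \<noteq> 0\<close> by simp
  have "net_outflow E (($) x) u = 0" for u
    using grounded_laplacian_mult_vec[of E k v x u] ker xv by (simp split: if_splits)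
  from harmonic_imp_constant[OF assms(2) this, of _ v] xv show "x = 0"
    by (simp add: vec_eq_iff)
qed

theorem matrix_inv_grounded_laplacian_diag:
  assumes "symp E" and "connected_graph E" and "k \<noteq> 0"
  shows "matrix_inv (grounded_laplacian E k {v}) $ j $ j = 1 / k + effective_resistance E v j"
proof -
  let ?M = "grounded_laplacian E k {v}"
  define x where "x = matrix_inv ?M *v axis j 1"
  have xj: "x $ j = matrix_inv ?M $ j $ j"
    by (simp add: x_def matrix_vector_mult_basis column_def)
  have "?M ** matrix_inv ?M = mat 1"
    using invertible_grounded_laplacian[OF assms]
    unfolding invertible_def matrix_inv_def by (rule someI2_ex) blast
  then have Mx: "?M *v x = axis j 1"
    by (simp add: x_def matrix_vector_mul_assoc)
  have "k * x $ v = (\<Sum>u\<in>UNIV. (axis j 1 :: real^'a) $ u)"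
    using sum_grounded_laplacian_mult_vec[OF assms(1), of k v x] Mx by simp
  also have "\<dots> = 1"
    by (simp add: axis_def)
  finally have kxv: "k * x $ v = 1" .
  have "net_outflow E (($) x) u = (if u = j then 1 else 0) - (if u = v then 1 else 0)" for u
    using grounded_laplacian_mult_vec[of E k v x u] Mx kxv
    by (auto simp: axis_def split: if_splits)
  \<comment> \<open>Reversing the potential reverses the current, which now flows from \<open>v\<close> to \<open>j\<close>.\<close>
  then have "net_outflow E (\<lambda>u. - x $ u) u = (if u = v then 1 else 0) - (if u = j then 1 else 0)" for u
    by (simp add: net_outflow_minus)
  from effective_resistance_eq[OF assms(2) this]
  have "effective_resistance E v j = x $ j - x $ v" by simp
  moreover have "x $ v = 1 / k"
    using kxv \<open>k \<noteq> 0\<close> by (simp add: field_simps)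
  ultimately show ?thesis using xj by simp
qed

section \<open>The game with one attacked and one defense node\<close>

lemma payoff_singleton:
  assumes "symp E" and "connected_graph E" and "k \<noteq> 0"
  shows "payoff E k {j} {v} = (1 + 1 / k + effective_resistance E v j) / 2"
  by (simp add: payoff_def matrix_inv_grounded_laplacian_diag[OF assms] field_simps)

lemma Max_payoff_singleton:
  fixes E :: "'v::finite \<Rightarrow> 'v \<Rightarrow> bool"
  assumes "symp E" and "connected_graph E" and "k \<noteq> 0"
  shows "(MAX F\<in>{F. card F = 1}. payoff E k F {v}) = (1 + 1 / k + effective_eccentricity E v) / 2"
proof -
  let ?f = "\<lambda>r::real. (1 + 1 / k + r) / 2"
  have "{F. card F = 1} = range (\<lambda>j::'v. {j})"
    by (auto simp: card_1_singleton_iff)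
  then have "(\<lambda>F. payoff E k F {v}) ` {F. card F = 1} = ?f ` range (effective_resistance E v)"
    by (simp add: image_image payoff_singleton[OF assms])
  moreover have "mono ?f"
    by (simp add: mono_def)
  then have "?f (Max (range (effective_resistance E v))) = Max (?f ` range (effective_resistance E v))"
    by (rule mono_Max_commute) auto
  ultimately show ?thesis by (simp add: effective_eccentricity_def)
qed

lemma best_response_singleton_iff:
  assumes "symp E" and "connected_graph E" and "k \<noteq> 0"
  shows "best_response E k 1 {v} F \<longleftrightarrow>
           (\<exists>j. F = {j} \<and> is_arg_max (effective_resistance E v) (\<lambda>_. True) j)"
  unfolding best_response_def is_arg_max_def
proof -
  have "(card F = 1 \<and> \<not> (\<exists>G. card G = 1 \<and> payoff E k G {v} > payoff E k F {v})) \<longleftrightarrow>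
      (\<exists>j. F = {j} \<and> \<not> (\<exists>i. payoff E k {i} {v} > payoff E k {j} {v}))"
    by (metis One_nat_def card_1_singleton_iff)
  then show "(card F = 1 \<and> \<not> (\<exists>G. card G = 1 \<and> payoff E k G {v} > payoff E k F {v})) \<longleftrightarrow>
      (\<exists>j. F = {j} \<and> True \<and> \<not> (\<exists>i. True \<and> effective_resistance E v i > effective_resistance E v j))"
    by (simp add: payoff_singleton[OF assms])
qed

lemma optimal_defense_singleton_iff:
  assumes "symp E" and "connected_graph E" and "k \<noteq> 0"
  shows "optimal_defense E k 1 1 D \<longleftrightarrow> (\<exists>v. D = {v} \<and> v \<in> effective_center E)"
proof -
  have "optimal_defense E k 1 1 D \<longleftrightarrow>
      (\<exists>v. D = {v} \<and> (\<forall>w. \<not> (MAX F\<in>{F. card F = 1}. payoff E k F {w})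
                             < (MAX F\<in>{F. card F = 1}. payoff E k F {v})))"
    unfolding optimal_defense_def is_arg_min_def card_1_singleton_iff[of D]
    by (metis One_nat_def card_1_singleton_iff)
  then show ?thesis
    unfolding Max_payoff_singleton[OF assms] effective_center_def is_arg_min_def
    by simp
qed

theorem theorem3:
  fixes E :: "'v::finite \<Rightarrow> 'v \<Rightarrow> bool" and k :: real
  assumes "symp E" and "irreflp E" and "connected_graph E" and "k > 0"
  shows "(\<forall>D F. stackelberg_solution E k 1 1 D F \<longleftrightarrow>
            (\<exists>v j. D = {v} \<and> F = {j} \<and> v \<in> effective_center E \<and>
                   is_arg_max (effective_resistance E v) (\<lambda>_. True) j)) \<and>
         (\<forall>v \<in> effective_center E. \<forall>F. best_response E k 1 {v} F \<longleftrightarrow>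
            (\<exists>j. F = {j} \<and> is_arg_max (effective_resistance E v) (\<lambda>_. True) j))"
proof -
  from \<open>k > 0\<close> have "k \<noteq> 0" by simp
  note optimal = optimal_defense_singleton_iff[OF assms(1,3) this]
    and response = best_response_singleton_iff[OF assms(1,3) this]
  show ?thesis
    unfolding stackelberg_solution_def optimal using response by blast
qed

end
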